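(* Let $X$ be a complex Hilbert space and let $T$ and $S$ be Hermitian subspaces in $X^2$ with $D(T)\subset D(S)$ and $S(0)\subset T(0)$. If $S$ is $T$-bounded with $T$-bound less than $1$, then $T+S$ is self-adjoint if and only if $T$ is self-adjoint.
   Context: A subspace (linear relation) in $X^2=X\times X$ is a linear subspace $T\subset X\times X$, not necessarily closed. Domain: $D(T)=\{x:(x,f)\in T\text{ for some }f\in X\}$; $T(x)=\{f\in X:(x,f)\in T\}$; $T+S=\{(x,f+g):(x,f)\in T,(x,g)\in S\}$. The adjoint is $T^*=\{(y,g)\in X^2:\langle g,x\rangle=\langle y,f\rangle\text{ for all }(x,f)\in T\}$. $T$ is Hermitian if $T\subset T^*$ (no density of the domain is assumed) and self-adjoint if $T=T^*$. Norm at a point: for $x\in D(T)$, $\|T(x)\|$ is the norm in the quotient space $X/\overline{T(0)}$ of the class of any $f\in T(x)$; equivalently $\|T(x)\|=\mathrm{dist}(f,T(0))$ for any $f\in T(x)$. $S$ is $T$-bounded if $D(T)\subset D(S)$ and there is a constant $c\ge 0$ with $\|S(x)\|\le c(\|x\|+\|T(x)\|)$ for all $x\in D(T)$. In that case the $T$-bound of $S$ is the infimum of all $b\ge0$ for which there exists $a\ge0$ with $\|S(x)\|\le a\|x\|+b\|T(x)\|$ for all $x\in D(T)$. *)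

theory Defs
  imports "HOL-Analysis.Analysis"
begin

section \<open>Complex Hilbert spaces\<close>

text \<open>
  Complex Hilbert spaces are built on top of the real normed spaces of HOL-Analysis, so that norm,
  distance, topology and completeness are the library ones. The inner product is linear in its
  first argument and conjugate-linear in its second argument.
\<close>

class complex_vector = real_vector +
  fixes scaleC :: "complex \<Rightarrow> 'a \<Rightarrow> 'a" (infixr "*\<^sub>C" 75)
  assumes scaleC_add_right: "a *\<^sub>C (x + y) = a *\<^sub>C x + a *\<^sub>C y"
    and scaleC_add_left: "(a + b) *\<^sub>C x = a *\<^sub>C x + b *\<^sub>C x"
    and scaleC_scaleC: "a *\<^sub>C (b *\<^sub>C x) = (a * b) *\<^sub>C x"
    and scaleC_one: "1 *\<^sub>C x = x"
    and scaleR_scaleC: "r *\<^sub>R x = complex_of_real r *\<^sub>C x"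

class complex_inner = complex_vector + real_normed_vector +
  fixes cinner :: "'a \<Rightarrow> 'a \<Rightarrow> complex"
  assumes cinner_commute: "cinner x y = cnj (cinner y x)"
    and cinner_add_left: "cinner (x + y) z = cinner x z + cinner y z"
    and cinner_scaleC_left: "cinner (c *\<^sub>C x) y = c * cinner x y"
    and cinner_norm: "cinner x x = complex_of_real ((norm x)\<^sup>2)"

class chilbert_space = complex_inner + complete_space

instantiation complex :: chilbert_space
begin

definition "scaleC a (z :: complex) = a * z"
definition "cinner (z :: complex) w = z * cnj w"

instance
proof
  fix a b z w u :: complex and r :: real
  show "a *\<^sub>C (z + w) = a *\<^sub>C z + a *\<^sub>C w" "(a + b) *\<^sub>C z = a *\<^sub>C z + b *\<^sub>C z"
    "a *\<^sub>C (b *\<^sub>C z) = (a * b) *\<^sub>C z" "1 *\<^sub>C z = z" "r *\<^sub>R z = complex_of_real r *\<^sub>C z"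
    by (simp_all add: scaleC_complex_def algebra_simps scaleR_conv_of_real)
  show "cinner z w = cnj (cinner w z)" "cinner (z + w) u = cinner z u + cinner w u"
    "cinner (a *\<^sub>C z) w = a * cinner z w"
    by (simp_all add: cinner_complex_def scaleC_complex_def algebra_simps)
  show "cinner z z = complex_of_real ((norm z)\<^sup>2)"
    unfolding cinner_complex_def by (rule complex_norm_square[symmetric])
qed

end

instantiation prod :: (complex_vector, complex_vector) complex_vector
begin

definition "scaleC c (p :: 'a \<times> 'b) = (c *\<^sub>C fst p, c *\<^sub>C snd p)"

instance
  by standard (simp_all add: scaleC_prod_def scaleC_add_right scaleC_add_left scaleC_scaleC
    scaleC_one scaleR_prod_def scaleR_scaleC)

end

global_interpretation complex_vector: vector_space "scaleC :: complex \<Rightarrow> 'a \<Rightarrow> 'a :: complex_vector"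
  defines csubspace = complex_vector.subspace
  by standard (simp_all add: scaleC_add_right scaleC_add_left scaleC_scaleC scaleC_one)


section \<open>Linear relations\<close>

text \<open>
  A subspace of \<open>X\<^sup>2\<close> is a set \<open>T\<close> of pairs with \<open>csubspace T\<close>. Its domain is \<open>Domain T\<close> and
  \<open>T(x)\<close> is the relational image \<open>T `` {x}\<close>.
\<close>

definition rel_plus :: "('a :: plus \<times> 'a) set \<Rightarrow> ('a \<times> 'a) set \<Rightarrow> ('a \<times> 'a) set"
    (infixl "+\<^sub>r" 65) where
  "T +\<^sub>r S = {(x, f + g) | x f g. (x, f) \<in> T \<and> (x, g) \<in> S}"

definition rel_adjoint :: "('a :: complex_inner \<times> 'a) set \<Rightarrow> ('a \<times> 'a) set" where
  "rel_adjoint T = {(y, g). \<forall>(x, f) \<in> T. cinner g x = cinner y f}"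

definition hermitian_subspace :: "('a :: complex_inner \<times> 'a) set \<Rightarrow> bool" where
  "hermitian_subspace T \<longleftrightarrow> csubspace T \<and> T \<subseteq> rel_adjoint T"

definition self_adjoint :: "('a :: complex_inner \<times> 'a) set \<Rightarrow> bool" where
  "self_adjoint T \<longleftrightarrow> T = rel_adjoint T"

text \<open>The norm in the quotient space \<open>X / N\<close> of the class \<open>f + N\<close>.\<close>

definition quotient_norm :: "'a :: real_normed_vector set \<Rightarrow> 'a \<Rightarrow> real" where
  "quotient_norm N f = (INF n\<in>N. norm (f + n))"

text \<open>
  The choice of the representative in \<open>T(x)\<close> is immaterial, see \<open>rel_norm_eq\<close> and
  \<open>rel_norm_eq_infdist\<close> below. The value is meaningful for \<open>x \<in> Domain T\<close> only.
\<close>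

definition rel_norm :: "('a :: complex_inner \<times> 'a) set \<Rightarrow> 'a \<Rightarrow> real" where
  "rel_norm T x = quotient_norm (closure (T `` {0})) (SOME f. f \<in> T `` {x})"

definition rel_bounded :: "('a :: complex_inner \<times> 'a) set \<Rightarrow> ('a \<times> 'a) set \<Rightarrow> bool" where
  "rel_bounded T S \<longleftrightarrow> Domain T \<subseteq> Domain S \<and>
    (\<exists>c\<ge>0. \<forall>x\<in>Domain T. rel_norm S x \<le> c * (norm x + rel_norm T x))"

text \<open>
  The \<open>T\<close>-bound of \<open>S\<close>. If \<open>S\<close> is not \<open>T\<close>-bounded, the infimum may be over the empty set of reals
  and is then unspecified; it is only used together with \<open>rel_bounded T S\<close>.
\<close>

definition rel_bound :: "('a :: complex_inner \<times> 'a) set \<Rightarrow> ('a \<times> 'a) set \<Rightarrow> real" where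
  "rel_bound T S =
    Inf {b. b \<ge> 0 \<and> (\<exists>a\<ge>0. \<forall>x\<in>Domain T. rel_norm S x \<le> a * norm x + b * rel_norm T x)}"

lemma csubspace_diff_mem_0:
  assumes "csubspace T" "(x, f) \<in> T" "(x, g) \<in> T"
  shows "f - g \<in> T `` {0}"
  using complex_vector.subspace_diff[OF assms] by simp

lemma csubspace_Image_0:
  assumes "csubspace T"
  shows "csubspace (T `` {0})"
proof (rule complex_vector.subspaceI)
  show "0 \<in> T `` {0}"
    using complex_vector.subspace_0[OF assms] by (simp add: zero_prod_def)
next
  fix f g assume "f \<in> T `` {0}" "g \<in> T `` {0}"
  then show "f + g \<in> T `` {0}"
    using complex_vector.subspace_add[OF assms, of "(0, f)" "(0, g)"] by simp
next
  fix c f assume "f \<in> T `` {0}"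
  then show "c *\<^sub>C f \<in> T `` {0}"
    using complex_vector.subspace_scale[OF assms, of "(0, f)" c] by (simp add: scaleC_prod_def)
qed

lemma csubspace_imp_subspace: "csubspace V \<Longrightarrow> subspace V"
  unfolding subspace_def scaleR_scaleC
  by (auto intro: complex_vector.subspace_0 complex_vector.subspace_add complex_vector.subspace_scale)

lemma subspace_closure:
  fixes N :: "'a :: real_normed_vector set"
  assumes "subspace N"
  shows "subspace (closure N)"
proof (rule subspaceI)
  show "0 \<in> closure N"
    using subspace_0[OF assms] closure_subset by blast
next
  fix x y assume "x \<in> closure N" "y \<in> closure N"
  then obtain X Y where "\<forall>n. X n \<in> N" "X \<longlonglongrightarrow> x" "\<forall>n. Y n \<in> N" "Y \<longlonglongrightarrow> y"
    unfolding closure_sequential by blast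
  then have "\<forall>n. X n + Y n \<in> N" "(\<lambda>n. X n + Y n) \<longlonglongrightarrow> x + y"
    using subspace_add[OF assms] by (auto intro: tendsto_add)
  then show "x + y \<in> closure N"
    unfolding closure_sequential by (intro exI conjI)
next
  fix c :: real and x assume "x \<in> closure N"
  then obtain X where "\<forall>n. X n \<in> N" "X \<longlonglongrightarrow> x"
    unfolding closure_sequential by blast
  then have "\<forall>n. c *\<^sub>R X n \<in> N" "(\<lambda>n. c *\<^sub>R X n) \<longlonglongrightarrow> c *\<^sub>R x"
    using subspace_scale[OF assms] by (auto intro: tendsto_scaleR)
  then show "c *\<^sub>R x \<in> closure N"
    unfolding closure_sequential by (intro exI conjI)
qed

lemma quotient_norm_eq_infdist:
  assumes "subspace N"
  shows "quotient_norm N f = infdist f N"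
proof -
  have "uminus ` N = N"
    using assms subspace_neg by force
  then have "quotient_norm N f = (INF n\<in>uminus ` N. norm (f + n))"
    by (simp add: quotient_norm_def)
  also have "\<dots> = (INF n\<in>N. dist f n)"
    by (simp add: image_image dist_norm)
  also have "\<dots> = infdist f N"
    using subspace_0[OF assms] by (auto simp: infdist_def)
  finally show ?thesis .
qed

lemma rel_norm_eq_infdist:
  assumes "csubspace T" "(x, f) \<in> T"
  shows "rel_norm T x = infdist f (T `` {0})"
proof -
  let ?N = "T `` {0}" and ?g = "SOME f. f \<in> T `` {x}"
  have N: "subspace ?N"
    using assms(1) by (intro csubspace_imp_subspace csubspace_Image_0)
  have g: "(x, ?g) \<in> T"
    using someI[of "\<lambda>f. f \<in> T `` {x}" f] assms(2) by simp
  have le: "infdist u ?N \<le> infdist v ?N" if "(x, u) \<in> T" "(x, v) \<in> T" for u v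
  proof -
    have "infdist u ?N \<le> dist v n" if "n \<in> ?N" for n
    proof -
      have "n + (u - v) \<in> ?N"
        using \<open>n \<in> ?N\<close> csubspace_diff_mem_0[OF assms(1) \<open>(x, u) \<in> T\<close> \<open>(x, v) \<in> T\<close>]
        by (rule subspace_add[OF N])
      then have "infdist u ?N \<le> dist u (n + (u - v))"
        by (rule infdist_le)
      then show ?thesis
        by (simp add: dist_norm)
    qed
    then show ?thesis
      using subspace_0[OF N] by (subst (2) infdist_def) (auto intro!: cINF_greatest)
  qed
  have "rel_norm T x = infdist ?g (closure ?N)"
    unfolding rel_norm_def by (rule quotient_norm_eq_infdist) (rule subspace_closure[OF N])
  also have "\<dots> = infdist ?g ?N"
    by (simp add: infdist_eq_setdist)
  also have "\<dots> = infdist f ?N"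
    using le g assms(2) by (blast intro: antisym)
  finally show ?thesis .
qed

lemma rel_norm_eq:
  assumes "csubspace T" "(x, f) \<in> T"
  shows "rel_norm T x = quotient_norm (closure (T `` {0})) f"
proof -
  have "subspace (T `` {0})"
    using assms(1) by (intro csubspace_imp_subspace csubspace_Image_0)
  then show ?thesis
    by (simp add: rel_norm_eq_infdist[OF assms] quotient_norm_eq_infdist subspace_closure
      infdist_eq_setdist)
qed

end

theory Submission
  imports Defs
begin

text \<open>
  The heart of the matter is a Kato--Rellich argument for linear relations
  (\<open>self_adjoint_rel_plus\<close>). A Hermitian relation \<open>A\<close> is self-adjoint as soon as the relations
  \<open>A - c\<close> and \<open>A - cnj c\<close> have full range for one \<open>c\<close>, and a self-adjoint relation has this property
  for every \<open>c = i r\<close> with \<open>r \<noteq> 0\<close>. Let \<open>T\<close> be self-adjoint with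
  \<open>\<parallel>S(x)\<parallel> \<le> a \<parallel>x\<parallel> + b \<parallel>f\<parallel>\<close> for \<open>(x, f) \<in> T\<close>, where \<open>b < 1\<close>. Given \<open>u\<close>, solve \<open>f - i r x = u\<close>
  in \<open>T\<close>. Since \<open>\<parallel>u\<parallel>\<^sup>2 = \<parallel>f\<parallel>\<^sup>2 + r\<^sup>2 \<parallel>x\<parallel>\<^sup>2\<close>, the class \<open>S(x)\<close> has elements of norm at most \<open>q \<parallel>u\<parallel>\<close>, up to an
  arbitrarily small error, where \<open>q = a / \<bar>r\<bar> + b < 1\<close> for large \<open>\<bar>r\<bar>\<close>. Hence the range of
  \<open>T + S - i r\<close> comes within \<open>q \<parallel>u\<parallel>\<close> of every \<open>u\<close>, and a subspace with this property is dense
  (\<open>dense_if_uniformly_close\<close>). It is also closed, because \<open>T + S\<close> is closed (\<open>closed_rel_plus\<close>).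

  Closedness of \<open>T + S\<close> is where the multivalued parts enter: the \<open>T\<close>-components of a convergent
  sequence in \<open>T + S\<close> are determined only up to \<open>T(0)\<close> and need not converge. Choosing them
  orthogonal to \<open>T(0)\<close>, hence of minimal norm, makes them converge, and \<open>S(0) \<subseteq> T(0)\<close> lets \<open>T\<close>
  absorb the ambiguity of \<open>S\<close>.

  For the converse one would like to subtract \<open>S\<close> from \<open>T + S\<close>, which gives back \<open>T\<close> because
  \<open>S(0) \<subseteq> T(0)\<close>. However, the bound of \<open>S\<close> relative to \<open>T + S\<close> is only known to be at most
  \<open>b / (1 - b)\<close>, which may exceed \<open>1\<close>. The same number bounds \<open>S\<close> relative to every \<open>T + t S\<close> with
  \<open>0 \<le> t \<le> 1\<close> (\<open>bounded_with_rel_plus_scale\<close>), so \<open>S\<close> can be removed in \<open>n\<close> equal portions,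
  each of which is a small perturbation if \<open>n > b / (1 - b)\<close> (\<open>self_adjoint_if_rel_plus\<close>).
\<close>

section \<open>Inner product geometry\<close>

lemma cinner_add_right: "cinner x (y + z) = cinner x y + cinner x (z :: 'a :: complex_inner)"
  by (metis cinner_add_left cinner_commute complex_cnj_add)

lemma cinner_scaleC_right: "cinner x (c *\<^sub>C y) = cnj c * cinner x (y :: 'a :: complex_inner)"
  by (metis cinner_scaleC_left cinner_commute complex_cnj_mult)

lemma cinner_scaleR_left: "cinner (r *\<^sub>R x) y = of_real r * cinner x (y :: 'a :: complex_inner)"
  by (simp add: scaleR_scaleC cinner_scaleC_left)

lemma cinner_scaleR_right: "cinner x (r *\<^sub>R y) = of_real r * cinner x (y :: 'a :: complex_inner)"
  by (simp add: scaleR_scaleC cinner_scaleC_right)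

lemma cinner_zero_left [simp]: "cinner 0 (y :: 'a :: complex_inner) = 0"
  using cinner_scaleR_left[of 0 0 y] by simp

lemma cinner_zero_right [simp]: "cinner (x :: 'a :: complex_inner) 0 = 0"
  using cinner_scaleR_right[of x 0 0] by simp

lemma cinner_minus_left: "cinner (- x) y = - cinner x (y :: 'a :: complex_inner)"
  using cinner_scaleR_left[of "-1" x y] by simp

lemma cinner_minus_right: "cinner x (- y) = - cinner x (y :: 'a :: complex_inner)"
  using cinner_scaleR_right[of x "-1" y] by simp

lemma cinner_diff_left: "cinner (x - y) z = cinner x z - cinner y (z :: 'a :: complex_inner)"
  using cinner_add_left[of x "- y" z] by (simp add: cinner_minus_left)

lemma cinner_diff_right: "cinner x (y - z) = cinner x y - cinner x (z :: 'a :: complex_inner)"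
  using cinner_add_right[of x y "- z"] by (simp add: cinner_minus_right)

lemmas cinner_algebra = cinner_add_left cinner_add_right cinner_diff_left cinner_diff_right
  cinner_scaleC_left cinner_scaleC_right

lemma norm_scaleC: "norm (c *\<^sub>C x) = cmod c * norm (x :: 'a :: complex_inner)"
proof -
  have "complex_of_real ((norm (c *\<^sub>C x))\<^sup>2) = c * cnj c * of_real ((norm x)\<^sup>2)"
    by (simp only: cinner_norm[symmetric] cinner_scaleC_left cinner_scaleC_right ac_simps)
  also have "\<dots> = complex_of_real ((cmod c * norm x)\<^sup>2)"
    by (simp add: complex_norm_square[symmetric] power_mult_distrib)
  finally have "(norm (c *\<^sub>C x))\<^sup>2 = (cmod c * norm x)\<^sup>2"
    using of_real_eq_iff by blast
  then show ?thesis
    by (rule power2_eq_imp_eq) simp_all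
qed

lemma bounded_linear_scaleC_right: "bounded_linear (\<lambda>x :: 'a :: complex_inner. c *\<^sub>C x)"
  by (rule bounded_linear_intro[where K = "cmod c"])
    (simp_all add: scaleC_add_right scaleR_scaleC scaleC_scaleC norm_scaleC mult.commute)

lemma norm_diff_sq:
  "complex_of_real ((norm (x - y))\<^sup>2) = of_real ((norm x)\<^sup>2) + of_real ((norm y)\<^sup>2)
     - cinner x y - cinner y (x :: 'a :: complex_inner)"
  by (simp only: cinner_norm[symmetric] cinner_diff_left cinner_diff_right) (simp add: algebra_simps)

lemma norm_add_sq:
  "complex_of_real ((norm (x + y))\<^sup>2) = of_real ((norm x)\<^sup>2) + of_real ((norm y)\<^sup>2)
     + cinner x y + cinner y (x :: 'a :: complex_inner)"
  by (simp only: cinner_norm[symmetric] cinner_add_left cinner_add_right) (simp add: algebra_simps)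

lemma pythagoras:
  fixes x y :: "'a :: complex_inner"
  assumes "cinner x y = 0"
  shows "(norm (x + y))\<^sup>2 = (norm x)\<^sup>2 + (norm y)\<^sup>2"
proof -
  have "cinner y x = 0"
    using assms cinner_commute[of y x] by simp
  then have "complex_of_real ((norm (x + y))\<^sup>2) = of_real ((norm x)\<^sup>2 + (norm y)\<^sup>2)"
    using assms norm_add_sq[of x y] by simp
  then show ?thesis
    using of_real_eq_iff by blast
qed

lemma parallelogram:
  fixes x y :: "'a :: complex_inner"
  shows "(norm (x + y))\<^sup>2 + (norm (x - y))\<^sup>2 = 2 * (norm x)\<^sup>2 + 2 * (norm y)\<^sup>2"
proof -
  have "complex_of_real ((norm (x + y))\<^sup>2 + (norm (x - y))\<^sup>2)
      = of_real (2 * (norm x)\<^sup>2 + 2 * (norm y)\<^sup>2)"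
    using norm_add_sq[of x y] norm_diff_sq[of x y] by simp
  then show ?thesis
    using of_real_eq_iff by blast
qed

text \<open>
  Removing from \<open>x\<close> its component along \<open>y\<close> shortens \<open>x\<close> by an explicit amount. That the
  result is nonnegative is the Cauchy--Schwarz inequality; that the shortening is strict unless
  \<open>x\<close> is orthogonal to \<open>y\<close> makes nearest points orthogonal projections.
\<close>

lemma norm_diff_component_sq:
  fixes x y :: "'a :: complex_inner"
  assumes "y \<noteq> 0"
  shows "(norm (x - (cinner x y / of_real ((norm y)\<^sup>2)) *\<^sub>C y))\<^sup>2
    = (norm x)\<^sup>2 - (cmod (cinner x y))\<^sup>2 / (norm y)\<^sup>2"
proof -
  define c where "c = cinner x y / of_real ((norm y)\<^sup>2)"
  have "cinner (x - c *\<^sub>C y) (c *\<^sub>C y) = 0"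
    using assms by (simp add: cinner_algebra cinner_norm c_def)
  then have "(norm x)\<^sup>2 = (norm (x - c *\<^sub>C y))\<^sup>2 + (norm (c *\<^sub>C y))\<^sup>2"
    using pythagoras[of "x - c *\<^sub>C y" "c *\<^sub>C y"] by simp
  moreover have "(norm (c *\<^sub>C y))\<^sup>2 = (cmod (cinner x y))\<^sup>2 / (norm y)\<^sup>2"
    using assms by (simp add: norm_scaleC c_def norm_divide norm_power power_mult_distrib power_divide)
      (simp add: field_simps flip: power_mult power_add)
  ultimately show ?thesis
    unfolding c_def by simp
qed

lemma cauchy_schwarz: "cmod (cinner x y) \<le> norm x * norm (y :: 'a :: complex_inner)"
proof (cases "y = 0")
  case False
  then have "(cmod (cinner x y))\<^sup>2 / (norm y)\<^sup>2 \<le> (norm x)\<^sup>2"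
    using norm_diff_component_sq[OF False, of x]
    by (metis diff_ge_0_iff_ge zero_le_power2)
  then have "(cmod (cinner x y))\<^sup>2 \<le> (norm x * norm y)\<^sup>2"
    using False by (simp add: field_simps power_mult_distrib)
  then show ?thesis
    by (rule power2_le_imp_le) simp
qed simp

lemma bounded_bilinear_cinner: "bounded_bilinear (cinner :: 'a :: complex_inner \<Rightarrow> 'a \<Rightarrow> complex)"
  by standard (auto simp: cinner_algebra cinner_scaleR_left cinner_scaleR_right scaleR_conv_of_real
      intro!: exI[of _ 1] cauchy_schwarz)

text \<open>
  By the parallelogram law, points of \<open>V\<close> whose distance to \<open>u\<close> tends to the minimum form a Cauchy
  sequence. Its limit \<open>v\<close> is a nearest point, and \<open>u - v\<close> is orthogonal to \<open>V\<close> because otherwise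
  removing a component along an element of \<open>V\<close> would bring \<open>v\<close> closer to \<open>u\<close>.
\<close>

lemma orthogonal_decomposition:
  fixes V :: "'a :: chilbert_space set"
  assumes "closed V" "csubspace V"
  obtains v where "v \<in> V" "\<And>w. w \<in> V \<Longrightarrow> cinner (u - v) w = 0"
proof -
  note V = csubspace_imp_subspace[OF assms(2)]
  have "V \<noteq> {}"
    using subspace_0[OF V] by blast
  define d where "d = infdist u V"
  have d0: "d \<ge> 0"
    by (simp add: d_def infdist_nonneg)
  have d_le: "d \<le> norm (u - v)" if "v \<in> V" for v
    using infdist_le[OF that, of u] by (simp add: d_def dist_norm)
  have "\<exists>v\<in>V. (norm (u - v))\<^sup>2 < d\<^sup>2 + 1 / Suc n" for n
  proof -
    have lt: "d < sqrt (d\<^sup>2 + 1 / Suc n)"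
      using d0 by (intro real_less_rsqrt) simp
    have "\<exists>v\<in>V. norm (u - v) < sqrt (d\<^sup>2 + 1 / Suc n)"
    proof (rule ccontr)
      assume "\<not> ?thesis"
      then have "sqrt (d\<^sup>2 + 1 / Suc n) \<le> d"
        using \<open>V \<noteq> {}\<close> unfolding d_def infdist_def
        by (auto simp: dist_norm not_less intro!: cINF_greatest)
      then show False using lt by simp
    qed
    then obtain v where "v \<in> V" "norm (u - v) < sqrt (d\<^sup>2 + 1 / Suc n)" by blast
    then have "(norm (u - v))\<^sup>2 < (sqrt (d\<^sup>2 + 1 / Suc n))\<^sup>2"
      by (intro power_strict_mono) auto
    then show ?thesis using \<open>v \<in> V\<close> by auto
  qed
  then obtain v where v: "\<And>n. v n \<in> V" "\<And>n. (norm (u - v n))\<^sup>2 < d\<^sup>2 + 1 / Suc n"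
    by metis
  have gap: "(norm (v n - v m))\<^sup>2 < 4 / Suc N" if "n \<ge> N" "m \<ge> N" for n m N
  proof -
    have "(1/2) *\<^sub>R (v n + v m) \<in> V"
      by (intro subspace_scale[OF V] subspace_add[OF V] v)
    then have "d \<le> norm (u - (1/2) *\<^sub>R (v n + v m))"
      by (rule d_le)
    also have "u - (1/2) *\<^sub>R (v n + v m) = (1/2) *\<^sub>R ((u - v n) + (u - v m))"
      using scaleR_half_double[of u] by (simp add: scaleR_add_right scaleR_diff_right)
    finally have "2 * d \<le> norm ((u - v n) + (u - v m))"
      by simp
    then have "(2 * d)\<^sup>2 \<le> (norm ((u - v n) + (u - v m)))\<^sup>2"
      using d0 by (intro power_mono) auto
    moreover have "1 / Suc n \<le> 1 / real (Suc N)" "1 / Suc m \<le> 1 / real (Suc N)"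
      using that by (auto intro!: divide_left_mono)
    moreover have "norm (v n - v m) = norm ((u - v n) - (u - v m))"
      by (simp add: norm_minus_commute)
    ultimately show ?thesis
      using parallelogram[of "u - v n" "u - v m"] v(2)[of n] v(2)[of m]
      by (simp add: power_mult_distrib)
  qed
  have "Cauchy v"
  proof (rule metric_CauchyI)
    fix e :: real assume "e > 0"
    obtain N :: nat where "4 / e\<^sup>2 < real N"
      using reals_Archimedean2 by blast
    then have "4 / e\<^sup>2 < real (Suc N)"
      by simp
    then have "4 / Suc N < e\<^sup>2"
      using \<open>e > 0\<close> by (simp add: field_simps)
    then have "norm (v m - v n) < e" if "m \<ge> N" "n \<ge> N" for m n
      using gap[OF that] \<open>e > 0\<close> by (intro power2_less_imp_less[of _ e]) auto
    then show "\<exists>N. \<forall>m\<ge>N. \<forall>n\<ge>N. dist (v m) (v n) < e"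
      by (auto simp: dist_norm)
  qed
  then obtain l where l: "v \<longlonglongrightarrow> l"
    using Cauchy_convergent convergent_def by blast
  have "l \<in> V"
    using closed_sequentially[OF assms(1) v(1) l] .
  have "(\<lambda>n. (norm (u - v n))\<^sup>2) \<longlonglongrightarrow> (norm (u - l))\<^sup>2"
    by (intro tendsto_intros l)
  moreover have "(\<lambda>n. d\<^sup>2 + 1 / Suc n) \<longlonglongrightarrow> d\<^sup>2 + 0"
    by (intro tendsto_intros LIMSEQ_Suc[OF lim_1_over_n])
  ultimately have "(norm (u - l))\<^sup>2 \<le> d\<^sup>2 + 0"
    using v(2) by (intro LIMSEQ_le) (auto intro: less_imp_le)
  have "cinner (u - l) w = 0" if "w \<in> V" for w
  proof (cases "w = 0")
    case False
    define c where "c = cinner (u - l) w / of_real ((norm w)\<^sup>2)"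
    have "l + c *\<^sub>C w \<in> V"
      using assms(2) \<open>l \<in> V\<close> \<open>w \<in> V\<close> by (intro complex_vector.subspace_add complex_vector.subspace_scale)
    then have "d\<^sup>2 \<le> (norm (u - l - c *\<^sub>C w))\<^sup>2"
      using d_le[of "l + c *\<^sub>C w"] d0 by (intro power_mono) (auto simp: diff_diff_eq)
    then have "(cmod (cinner (u - l) w))\<^sup>2 / (norm w)\<^sup>2 \<le> 0"
      using \<open>(norm (u - l))\<^sup>2 \<le> d\<^sup>2 + 0\<close> norm_diff_component_sq[OF False, of "u - l"]
      unfolding c_def by linarith
    then show ?thesis
      using False by (simp add: divide_le_0_iff)
  qed simp
  with \<open>l \<in> V\<close> show thesis by (rule that)
qed


section \<open>The range criterion for self-adjointness\<close>

text \<open>The range of the relation \<open>T - c I\<close>.\<close>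

definition rel_shift_range :: "complex \<Rightarrow> ('a :: complex_inner \<times> 'a) set \<Rightarrow> 'a set" where
  "rel_shift_range c T = {f - c *\<^sub>C x | x f. (x, f) \<in> T}"

lemma csubspace_addD: "csubspace T \<Longrightarrow> (x, f) \<in> T \<Longrightarrow> (y, g) \<in> T \<Longrightarrow> (x + y, f + g) \<in> T"
  using complex_vector.subspace_add[of T "(x, f)" "(y, g)"] by simp

lemma csubspace_diffD: "csubspace T \<Longrightarrow> (x, f) \<in> T \<Longrightarrow> (y, g) \<in> T \<Longrightarrow> (x - y, f - g) \<in> T"
  using complex_vector.subspace_diff[of T "(x, f)" "(y, g)"] by simp

lemma csubspace_scaleD: "csubspace T \<Longrightarrow> (x, f) \<in> T \<Longrightarrow> (c *\<^sub>C x, c *\<^sub>C f) \<in> T"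
  using complex_vector.subspace_scale[of T "(x, f)" c] by (simp add: scaleC_prod_def)

lemma csubspace_relI:
  fixes T :: "('a :: complex_vector \<times> 'a) set"
  assumes "(0, 0) \<in> T"
    and "\<And>x f y g. (x, f) \<in> T \<Longrightarrow> (y, g) \<in> T \<Longrightarrow> (x + y, f + g) \<in> T"
    and "\<And>c x f. (x, f) \<in> T \<Longrightarrow> (c *\<^sub>C x, c *\<^sub>C f) \<in> T"
  shows "csubspace T"
  using assms by (intro complex_vector.subspaceI) (auto simp: zero_prod_def scaleC_prod_def)

lemma rel_shift_rangeI: "(x, f) \<in> T \<Longrightarrow> f - c *\<^sub>C x \<in> rel_shift_range c T"
  unfolding rel_shift_range_def by blast

lemma rel_shift_rangeE:
  assumes "u \<in> rel_shift_range c T"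
  obtains x f where "(x, f) \<in> T" "u = f - c *\<^sub>C x"
  using assms unfolding rel_shift_range_def by blast

lemma csubspace_rel_shift_range:
  assumes "csubspace T"
  shows "csubspace (rel_shift_range c T)"
proof (rule complex_vector.subspaceI)
  have "(0, 0) \<in> T"
    using complex_vector.subspace_0[OF assms] by (simp add: zero_prod_def)
  from rel_shift_rangeI[OF this, of c] show "0 \<in> rel_shift_range c T"
    by simp
next
  fix u v assume "u \<in> rel_shift_range c T" "v \<in> rel_shift_range c T"
  then obtain x f y g where "(x, f) \<in> T" "u = f - c *\<^sub>C x" "(y, g) \<in> T" "v = g - c *\<^sub>C y"
    by (elim rel_shift_rangeE)
  then show "u + v \<in> rel_shift_range c T"
    using rel_shift_rangeI[OF csubspace_addD[OF assms, of x f y g], of c]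
    by (simp add: scaleC_add_right add_diff_add)
next
  fix r u assume "u \<in> rel_shift_range c T"
  then obtain x f where "(x, f) \<in> T" "u = f - c *\<^sub>C x"
    by (rule rel_shift_rangeE)
  then show "r *\<^sub>C u \<in> rel_shift_range c T"
    using rel_shift_rangeI[OF csubspace_scaleD[OF assms, of x f r], of c]
    by (simp add: complex_vector.scale_right_diff_distrib scaleC_scaleC mult.commute)
qed

lemma rel_adjointD: "(y, g) \<in> rel_adjoint T \<Longrightarrow> (x, f) \<in> T \<Longrightarrow> cinner g x = cinner y f"
  by (auto simp: rel_adjoint_def)

lemma rel_adjointI:
  "(\<And>x f. (x, f) \<in> T \<Longrightarrow> cinner g x = cinner y f) \<Longrightarrow> (y, g) \<in> rel_adjoint T"
  by (auto simp: rel_adjoint_def)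

lemma csubspace_rel_adjoint: "csubspace (rel_adjoint T)"
proof (rule csubspace_relI)
  show "(0, 0) \<in> rel_adjoint T"
    by (rule rel_adjointI) simp
  show "(x + y, f + g) \<in> rel_adjoint T" if "(x, f) \<in> rel_adjoint T" "(y, g) \<in> rel_adjoint T" for x f y g
    using that by (intro rel_adjointI) (simp add: cinner_add_left rel_adjointD)
  show "(c *\<^sub>C x, c *\<^sub>C f) \<in> rel_adjoint T" if "(x, f) \<in> rel_adjoint T" for c x f
    using that by (intro rel_adjointI) (simp add: cinner_scaleC_left rel_adjointD)
qed

lemma closed_rel_adjoint: "closed (rel_adjoint T)"
proof -
  have "rel_adjoint T = (\<Inter>(x, f)\<in>T. {p. cinner (snd p) x = cinner (fst p) f})"
    by (auto simp: rel_adjoint_def)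
  also have "closed \<dots>"
    by (auto intro!: closed_INT closed_Collect_eq bounded_bilinear.continuous_on[OF bounded_bilinear_cinner]
        continuous_intros)
  finally show ?thesis .
qed

lemma hermitian_if_self_adjoint: "self_adjoint T \<Longrightarrow> hermitian_subspace T"
  unfolding self_adjoint_def hermitian_subspace_def by (metis csubspace_rel_adjoint order_refl)

lemma csubspace_if_hermitian: "hermitian_subspace T \<Longrightarrow> csubspace T"
  by (simp add: hermitian_subspace_def)

lemma closed_if_self_adjoint: "self_adjoint T \<Longrightarrow> closed T"
  unfolding self_adjoint_def by (metis closed_rel_adjoint)

lemma hermitian_cinner:
  "hermitian_subspace T \<Longrightarrow> (x, f) \<in> T \<Longrightarrow> (y, g) \<in> T \<Longrightarrow> cinner f y = cinner x g"
  unfolding hermitian_subspace_def by (blast dest: rel_adjointD)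

text \<open>
  For a Hermitian relation \<open>\<langle>f, x\<rangle>\<close> is real, so the cross terms of \<open>\<parallel>f - i r x\<parallel>\<^sup>2\<close> cancel.
\<close>

lemma hermitian_norm_shift:
  assumes "hermitian_subspace T" "(x, f) \<in> T"
  shows "(norm (f - (\<i> * of_real r) *\<^sub>C x))\<^sup>2 = (norm f)\<^sup>2 + r\<^sup>2 * (norm x)\<^sup>2"
proof -
  have "cinner f x = cinner x f"
    using hermitian_cinner[OF assms(1) assms(2) assms(2)] .
  then have "complex_of_real ((norm (f - (\<i> * of_real r) *\<^sub>C x))\<^sup>2)
      = of_real ((norm f)\<^sup>2 + (norm ((\<i> * of_real r) *\<^sub>C x))\<^sup>2)"
    unfolding norm_diff_sq by (simp add: cinner_algebra)
  then show ?thesis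
    unfolding of_real_eq_iff by (simp add: norm_scaleC norm_mult power_mult_distrib)
qed

lemma hermitian_norm_le:
  assumes "hermitian_subspace T" "(x, f) \<in> T"
  shows "norm f \<le> norm (f - (\<i> * of_real r) *\<^sub>C x)"
    and "\<bar>r\<bar> * norm x \<le> norm (f - (\<i> * of_real r) *\<^sub>C x)"
proof -
  have "(norm f)\<^sup>2 \<le> (norm (f - (\<i> * of_real r) *\<^sub>C x))\<^sup>2"
    "(\<bar>r\<bar> * norm x)\<^sup>2 \<le> (norm (f - (\<i> * of_real r) *\<^sub>C x))\<^sup>2"
    unfolding hermitian_norm_shift[OF assms] by (simp_all add: power_mult_distrib)
  then show "norm f \<le> norm (f - (\<i> * of_real r) *\<^sub>C x)"
    "\<bar>r\<bar> * norm x \<le> norm (f - (\<i> * of_real r) *\<^sub>C x)"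
    by (auto intro: power2_le_imp_le)
qed

lemma Cauchy_if_norm_le:
  fixes X :: "nat \<Rightarrow> 'a :: real_normed_vector" and Y :: "nat \<Rightarrow> 'b :: real_normed_vector"
  assumes "Cauchy Y" "\<And>m n. norm (X m - X n) \<le> K * norm (Y m - Y n)"
  shows "Cauchy X"
proof (rule metric_CauchyI)
  fix e :: real assume "e > 0"
  define L where "L = \<bar>K\<bar> + 1"
  have "L > 0" by (simp add: L_def)
  then obtain N where N: "\<And>m n. m \<ge> N \<Longrightarrow> n \<ge> N \<Longrightarrow> norm (Y m - Y n) < e / L"
    using metric_CauchyD[OF assms(1), of "e / L"] \<open>e > 0\<close> by (auto simp: dist_norm)
  have "norm (X m - X n) < e" if "m \<ge> N" "n \<ge> N" for m n
  proof -
    have "norm (X m - X n) \<le> L * norm (Y m - Y n)"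
      by (rule order_trans[OF assms(2) mult_right_mono]) (auto simp: L_def)
    also have "\<dots> < e"
      using N[OF that] \<open>L > 0\<close> by (simp add: field_simps)
    finally show ?thesis .
  qed
  then show "\<exists>N. \<forall>m\<ge>N. \<forall>n\<ge>N. dist (X m) (X n) < e"
    by (auto simp: dist_norm)
qed

text \<open>
  The value \<open>f - i r x\<close> controls both \<open>x\<close> and \<open>f\<close>, so convergence of the values forces
  convergence of the pairs \<open>(x, f)\<close>, and \<open>T\<close> contains their limit.
\<close>

lemma closed_rel_shift_range:
  fixes T :: "('a :: chilbert_space \<times> 'a) set"
  assumes T: "hermitian_subspace T" and "closed T" "r \<noteq> 0"
  shows "closed (rel_shift_range (\<i> * of_real r) T)"
  unfolding closed_sequential_limits
proof (intro allI impI, elim conjE)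
  let ?c = "\<i> * complex_of_real r"
  fix U l assume U: "U \<longlonglongrightarrow> l" and "\<forall>n. U n \<in> rel_shift_range ?c T"
  then have "\<exists>x f. (x, f) \<in> T \<and> U n = f - ?c *\<^sub>C x" for n
    using rel_shift_rangeE[of "U n" ?c T] by blast
  then obtain x f where xf: "\<And>n. (x n, f n) \<in> T" and U_eq: "\<And>n. U n = f n - ?c *\<^sub>C x n"
    by metis
  have diff: "(x m - x n, f m - f n) \<in> T" for m n
    by (rule csubspace_diffD[OF csubspace_if_hermitian[OF T] xf xf])
  have U_diff: "(f m - f n) - ?c *\<^sub>C (x m - x n) = U m - U n" for m n
    by (simp add: U_eq complex_vector.scale_right_diff_distrib)
  have "Cauchy U"
    using U by (rule LIMSEQ_imp_Cauchy)
  have "norm (x m - x n) \<le> (1 / \<bar>r\<bar>) * norm (U m - U n)" for m n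
    using hermitian_norm_le(2)[OF T diff[of m n], of r] \<open>r \<noteq> 0\<close>
    unfolding U_diff by (simp add: field_simps)
  with \<open>Cauchy U\<close> have "Cauchy x"
    by (rule Cauchy_if_norm_le)
  have "norm (f m - f n) \<le> 1 * norm (U m - U n)" for m n
    using hermitian_norm_le(1)[OF T diff[of m n], of r] unfolding U_diff by simp
  with \<open>Cauchy U\<close> have "Cauchy f"
    by (rule Cauchy_if_norm_le)
  obtain x' where x': "x \<longlonglongrightarrow> x'"
    using Cauchy_convergent[OF \<open>Cauchy x\<close>] unfolding convergent_def by (rule exE)
  obtain f' where f': "f \<longlonglongrightarrow> f'"
    using Cauchy_convergent[OF \<open>Cauchy f\<close>] unfolding convergent_def by (rule exE)
  have "(x', f') \<in> T"
    by (rule closed_sequentially[OF \<open>closed T\<close> xf tendsto_Pair[OF x' f']])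
  have "(\<lambda>n. f n - ?c *\<^sub>C x n) \<longlonglongrightarrow> f' - ?c *\<^sub>C x'"
    by (intro tendsto_diff f' bounded_linear.tendsto[OF bounded_linear_scaleC_right] x')
  then have "U \<longlonglongrightarrow> f' - ?c *\<^sub>C x'"
    unfolding U_eq .
  then have "l = f' - ?c *\<^sub>C x'"
    by (rule LIMSEQ_unique[OF U])
  with \<open>(x', f') \<in> T\<close> show "l \<in> rel_shift_range ?c T"
    by (simp add: rel_shift_rangeI)
qed

text \<open>
  The range is closed, so it suffices that its orthogonal complement is trivial. A vector \<open>w\<close>
  orthogonal to it satisfies \<open>(w, - i r w) \<in> T\<^sup>* = T\<close>; the norm identity applied to this pair with
  the shift \<open>- i r\<close> reads \<open>0 = 2 r\<^sup>2 \<parallel>w\<parallel>\<^sup>2\<close>.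
\<close>

lemma rel_shift_range_eq_UNIV:
  fixes T :: "('a :: chilbert_space \<times> 'a) set"
  assumes "self_adjoint T" "r \<noteq> 0"
  shows "rel_shift_range (\<i> * of_real r) T = UNIV"
proof -
  let ?c = "\<i> * complex_of_real r" and ?R = "rel_shift_range (\<i> * complex_of_real r) T"
  note T = hermitian_if_self_adjoint[OF assms(1)]
  note closed = closed_rel_shift_range[OF T closed_if_self_adjoint[OF assms(1)] assms(2)]
    and subspace = csubspace_rel_shift_range[OF csubspace_if_hermitian[OF T]]
  have "u \<in> ?R" for u
  proof -
    obtain v where v: "v \<in> ?R" "\<And>w. w \<in> ?R \<Longrightarrow> cinner (u - v) w = 0"
      using orthogonal_decomposition[OF closed subspace] by blast
    define w where "w = u - v"
    have "cinner w (f - ?c *\<^sub>C x) = 0" if "(x, f) \<in> T" for x f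
      unfolding w_def by (rule v(2)[OF rel_shift_rangeI[OF that]])
    then have "(w, cnj ?c *\<^sub>C w) \<in> rel_adjoint T"
      by (intro rel_adjointI) (simp only: cinner_algebra right_minus_eq)
    then have "(w, cnj ?c *\<^sub>C w) \<in> T"
      using equalityD2[OF assms(1)[unfolded self_adjoint_def]] by (rule subsetD[rotated])
    then have "r = 0 \<or> w = 0"
      using hermitian_norm_shift[OF T, of w "cnj ?c *\<^sub>C w" "-r"]
      by (simp add: norm_scaleC norm_mult power_mult_distrib)
    then show ?thesis
      using assms(2) v(1) by (simp add: w_def)
  qed
  then show ?thesis by blast
qed

text \<open>
  Given \<open>(y, g)\<close> in the adjoint, full range of \<open>T - c\<close> yields \<open>(x, h) \<in> T\<close> with
  \<open>g - c y = h - c x\<close>. The difference \<open>y - x\<close> then solves the eigenvalue equation of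
  \<open>T\<^sup>*\<close> at \<open>c\<close>, hence is orthogonal to the range of \<open>T - cnj c\<close>, which is everything.
\<close>

lemma self_adjoint_if_rel_shift_range_eq_UNIV:
  fixes T :: "('a :: complex_inner \<times> 'a) set"
  assumes T: "hermitian_subspace T"
    and c: "rel_shift_range c T = UNIV" "rel_shift_range (cnj c) T = UNIV"
  shows "self_adjoint T"
proof -
  have "(y, g) \<in> T" if yg: "(y, g) \<in> rel_adjoint T" for y g
  proof -
    have "g - c *\<^sub>C y \<in> rel_shift_range c T"
      using c(1) by simp
    then obtain x h where xh: "(x, h) \<in> T" "g - c *\<^sub>C y = h - c *\<^sub>C x"
      by (rule rel_shift_rangeE)
    have "(x, h) \<in> rel_adjoint T"
      using T xh(1) by (auto simp: hermitian_subspace_def)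
    then have yx: "(y - x, g - h) \<in> rel_adjoint T"
      by (rule csubspace_diffD[OF csubspace_rel_adjoint yg])
    have gh: "g - h = c *\<^sub>C (y - x)"
      using xh(2) by (simp add: complex_vector.scale_right_diff_distrib algebra_simps)
    have "y - x \<in> rel_shift_range (cnj c) T"
      using c(2) by simp
    then obtain x' f' where xf: "(x', f') \<in> T" "y - x = f' - cnj c *\<^sub>C x'"
      by (rule rel_shift_rangeE)
    have "cinner (c *\<^sub>C (y - x)) x' = cinner (y - x) f'"
      using rel_adjointD[OF yx xf(1)] by (simp only: gh)
    then have "cinner (y - x) (f' - cnj c *\<^sub>C x') = 0"
      by (simp add: cinner_diff_right[of _ f'] cinner_scaleC_left cinner_scaleC_right)
    then have "cinner (y - x) (y - x) = 0"
      using xf(2) by simp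
    then have "y = x"
      by (simp add: cinner_norm)
    with gh have "g = h"
      by simp
    with \<open>y = x\<close> xh(1) show ?thesis by simp
  qed
  with T show ?thesis
    by (auto simp: self_adjoint_def hermitian_subspace_def)
qed


section \<open>Sums of linear relations\<close>

lemma rel_plusI: "(x, f) \<in> T \<Longrightarrow> (x, g) \<in> S \<Longrightarrow> (x, f + g) \<in> T +\<^sub>r S"
  by (auto simp: rel_plus_def)

lemma rel_plusE:
  assumes "(x, h) \<in> T +\<^sub>r S"
  obtains f g where "(x, f) \<in> T" "(x, g) \<in> S" "h = f + g"
  using assms by (auto simp: rel_plus_def)

lemma csubspace_rel_plus:
  assumes "csubspace T" "csubspace S"
  shows "csubspace (T +\<^sub>r S)"
proof (rule csubspace_relI)
  have "(0, 0) \<in> T" "(0, 0) \<in> S"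
    using assms complex_vector.subspace_0[of T] complex_vector.subspace_0[of S] by (auto simp: zero_prod_def)
  from rel_plusI[OF this] show "(0, 0) \<in> T +\<^sub>r S"
    by simp
next
  fix x f y g assume "(x, f) \<in> T +\<^sub>r S" "(y, g) \<in> T +\<^sub>r S"
  then obtain f1 f2 g1 g2 where *: "(x, f1) \<in> T" "(x, f2) \<in> S" "f = f1 + f2"
    "(y, g1) \<in> T" "(y, g2) \<in> S" "g = g1 + g2"
    by (elim rel_plusE)
  have "f + g = (f1 + g1) + (f2 + g2)"
    using * by (simp add: algebra_simps)
  then show "(x + y, f + g) \<in> T +\<^sub>r S"
    using csubspace_addD[OF assms(1) *(1,4)] csubspace_addD[OF assms(2) *(2,5)] by (simp add: rel_plusI)
next
  fix c x h assume "(x, h) \<in> T +\<^sub>r S"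
  then obtain f g where "(x, f) \<in> T" "(x, g) \<in> S" "h = f + g"
    by (rule rel_plusE)
  then show "(c *\<^sub>C x, c *\<^sub>C h) \<in> T +\<^sub>r S"
    by (auto simp: scaleC_add_right intro!: rel_plusI csubspace_scaleD[OF assms(1)] csubspace_scaleD[OF assms(2)])
qed

lemma hermitian_rel_plus:
  assumes "hermitian_subspace T" "hermitian_subspace S"
  shows "hermitian_subspace (T +\<^sub>r S)"
  unfolding hermitian_subspace_def
proof
  show "csubspace (T +\<^sub>r S)"
    by (intro csubspace_rel_plus csubspace_if_hermitian assms)
  show "T +\<^sub>r S \<subseteq> rel_adjoint (T +\<^sub>r S)"
  proof clarify
    fix y h assume "(y, h) \<in> T +\<^sub>r S"
    then obtain h1 h2 where h: "(y, h1) \<in> T" "(y, h2) \<in> S" "h = h1 + h2"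
      by (rule rel_plusE)
    show "(y, h) \<in> rel_adjoint (T +\<^sub>r S)"
    proof (rule rel_adjointI)
      fix x k assume "(x, k) \<in> T +\<^sub>r S"
      then obtain k1 k2 where k: "(x, k1) \<in> T" "(x, k2) \<in> S" "k = k1 + k2"
        by (rule rel_plusE)
      show "cinner h x = cinner y k"
        using hermitian_cinner[OF assms(1) h(1) k(1)] hermitian_cinner[OF assms(2) h(2) k(2)]
        by (simp add: h(3) k(3) cinner_add_left cinner_add_right)
    qed
  qed
qed

text \<open>
  The relation \<open>t S\<close>. For \<open>t = 0\<close> this is the single-valued zero operator on \<open>D(S)\<close>, so the
  multivalued part of \<open>S\<close> is lost; if \<open>S(0) \<subseteq> T(0)\<close>, then \<open>T + t S\<close> has the multivalued part
  \<open>T(0)\<close> for every \<open>t\<close> all the same.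
\<close>

definition rel_scale :: "real \<Rightarrow> ('a :: complex_inner \<times> 'a) set \<Rightarrow> ('a \<times> 'a) set" where
  "rel_scale t S = (\<lambda>(x, g). (x, t *\<^sub>R g)) ` S"

lemma rel_scaleI: "(x, g) \<in> S \<Longrightarrow> (x, t *\<^sub>R g) \<in> rel_scale t S"
  by (force simp: rel_scale_def)

lemma rel_scaleE:
  assumes "(x, h) \<in> rel_scale t S"
  obtains g where "(x, g) \<in> S" "h = t *\<^sub>R g"
  using assms by (auto simp: rel_scale_def)

lemma Domain_rel_scale [simp]: "Domain (rel_scale t S) = Domain S"
  by (force simp: rel_scale_def)

lemma hermitian_rel_scale:
  assumes "hermitian_subspace S"
  shows "hermitian_subspace (rel_scale t S)"
  unfolding hermitian_subspace_def
proof
  have S: "csubspace S"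
    using assms by (rule csubspace_if_hermitian)
  show "csubspace (rel_scale t S)"
  proof (rule csubspace_relI)
    show "(0, 0) \<in> rel_scale t S"
      using rel_scaleI[of 0 0 S t] complex_vector.subspace_0[OF S] by (simp add: zero_prod_def)
    show "(x + y, f + g) \<in> rel_scale t S"
      if xf: "(x, f) \<in> rel_scale t S" and yg: "(y, g) \<in> rel_scale t S" for x f y g
    proof -
      obtain f' g' where "(x, f') \<in> S" "f = t *\<^sub>R f'" "(y, g') \<in> S" "g = t *\<^sub>R g'"
        using xf yg by (elim rel_scaleE)
      then show ?thesis
        using rel_scaleI[OF csubspace_addD[OF S, of x f' y g'], of t] by (simp add: scaleR_add_right)
    qed
    show "(c *\<^sub>C x, c *\<^sub>C f) \<in> rel_scale t S" if fxt: "(x, f) \<in> rel_scale t S" for c x f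
    proof -
      obtain g where "(x, g) \<in> S" "f = t *\<^sub>R g"
        using fxt by (rule rel_scaleE)
      moreover have "c *\<^sub>C (t *\<^sub>R g) = t *\<^sub>R (c *\<^sub>C g)"
        by (simp add: scaleR_scaleC scaleC_scaleC mult.commute)
      ultimately show ?thesis
        using csubspace_scaleD[OF S, of x g c] by (simp add: rel_scaleI)
    qed
  qed
  show "rel_scale t S \<subseteq> rel_adjoint (rel_scale t S)"
  proof clarify
    fix y h assume "(y, h) \<in> rel_scale t S"
    then obtain g where g: "(y, g) \<in> S" "h = t *\<^sub>R g"
      by (rule rel_scaleE)
    show "(y, h) \<in> rel_adjoint (rel_scale t S)"
    proof (rule rel_adjointI)
      fix x k assume "(x, k) \<in> rel_scale t S"
      then obtain g' where g': "(x, g') \<in> S" "k = t *\<^sub>R g'"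
        by (rule rel_scaleE)
      show "cinner h x = cinner y k"
        using hermitian_cinner[OF assms g(1) g'(1)]
        by (simp add: g(2) g'(2) cinner_scaleR_left cinner_scaleR_right)
    qed
  qed
qed

lemma rel_scale_1 [simp]: "rel_scale 1 S = S"
  by (force simp: rel_scale_def)

lemma rel_scale_Image_0_subset:
  assumes "csubspace T" "S `` {0} \<subseteq> T `` {0}"
  shows "rel_scale t S `` {0} \<subseteq> T `` {0}"
  using assms(2) subspace_scale[OF csubspace_imp_subspace[OF csubspace_Image_0[OF assms(1)]]]
  by (auto elim!: rel_scaleE)

lemma rel_plus_scale_0:
  assumes "csubspace T" "Domain T \<subseteq> Domain S"
  shows "T +\<^sub>r rel_scale 0 S = T"
proof
  show "T +\<^sub>r rel_scale 0 S \<subseteq> T"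
    by (auto elim!: rel_plusE rel_scaleE)
  show "T \<subseteq> T +\<^sub>r rel_scale 0 S"
  proof clarify
    fix x f assume "(x, f) \<in> T"
    moreover then obtain g where "(x, g) \<in> S"
      using assms(2) by blast
    ultimately show "(x, f) \<in> T +\<^sub>r rel_scale 0 S"
      using rel_plusI[OF _ rel_scaleI[of x g S 0], of f T] by simp
  qed
qed

text \<open>
  In general \<open>s S + t S\<close> is larger than \<open>(s + t) S\<close>, since different elements of \<open>S(x)\<close> may be
  chosen in the two summands; they differ by an element of \<open>S(0)\<close>, which \<open>T\<close> absorbs.
\<close>

lemma rel_plus_scale_scale:
  assumes T: "csubspace T" and S: "csubspace S" and S0: "S `` {0} \<subseteq> T `` {0}"
  shows "T +\<^sub>r rel_scale s S +\<^sub>r rel_scale t S = T +\<^sub>r rel_scale (s + t) S"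
proof
  show "T +\<^sub>r rel_scale s S +\<^sub>r rel_scale t S \<subseteq> T +\<^sub>r rel_scale (s + t) S"
  proof clarify
    fix x h assume "(x, h) \<in> T +\<^sub>r rel_scale s S +\<^sub>r rel_scale t S"
    then obtain f g g' where *: "(x, f) \<in> T" "(x, g) \<in> S" "(x, g') \<in> S" "h = f + s *\<^sub>R g + t *\<^sub>R g'"
      by (auto elim!: rel_plusE rel_scaleE)
    have "t *\<^sub>R (g' - g) \<in> T `` {0}"
      using csubspace_diff_mem_0[OF S *(3,2)] S0
      by (intro subspace_scale[OF csubspace_imp_subspace[OF csubspace_Image_0[OF T]]]) blast
    then have "(x, f + t *\<^sub>R (g' - g)) \<in> T"
      using csubspace_addD[OF T *(1), of 0 "t *\<^sub>R (g' - g)"] by simp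
    then have "(x, f + t *\<^sub>R (g' - g) + (s + t) *\<^sub>R g) \<in> T +\<^sub>r rel_scale (s + t) S"
      using *(2) by (intro rel_plusI rel_scaleI)
    then show "(x, h) \<in> T +\<^sub>r rel_scale (s + t) S"
      by (simp add: *(4) algebra_simps)
  qed
  show "T +\<^sub>r rel_scale (s + t) S \<subseteq> T +\<^sub>r rel_scale s S +\<^sub>r rel_scale t S"
  proof clarify
    fix x h assume "(x, h) \<in> T +\<^sub>r rel_scale (s + t) S"
    then obtain f g where *: "(x, f) \<in> T" "(x, g) \<in> S" "h = f + (s + t) *\<^sub>R g"
      by (auto elim!: rel_plusE rel_scaleE)
    then have "(x, f + s *\<^sub>R g + t *\<^sub>R g) \<in> T +\<^sub>r rel_scale s S +\<^sub>r rel_scale t S"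
      by (intro rel_plusI rel_scaleI)
    then show "(x, h) \<in> T +\<^sub>r rel_scale s S +\<^sub>r rel_scale t S"
      by (simp add: *(3) scaleR_add_left add.assoc)
  qed
qed


section \<open>Relative bounds\<close>

lemma rel_norm_le:
  assumes "csubspace T" "(x, f) \<in> T"
  shows "rel_norm T x \<le> norm f"
  using infdist_le[OF complex_vector.subspace_0[OF csubspace_Image_0[OF assms(1)]], of f]
  by (simp add: rel_norm_eq_infdist[OF assms])

lemma rel_norm_approx:
  assumes "csubspace T" "x \<in> Domain T" "e > 0"
  obtains f where "(x, f) \<in> T" "norm f < rel_norm T x + e"
proof -
  obtain f where f: "(x, f) \<in> T"
    using assms(2) by blast
  have ne: "T `` {0} \<noteq> {}"
    using complex_vector.subspace_0[OF csubspace_Image_0[OF assms(1)]] by blast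
  have "\<exists>n\<in>T `` {0}. dist f n < rel_norm T x + e"
  proof (rule ccontr)
    assume "\<not> ?thesis"
    then have "rel_norm T x + e \<le> infdist f (T `` {0})"
      using ne unfolding infdist_def by (auto simp: not_less intro!: cINF_greatest)
    then show False
      using rel_norm_eq_infdist[OF assms(1) f] assms(3) by simp
  qed
  then obtain n where "(0, n) \<in> T" "norm (f - n) < rel_norm T x + e"
    by (auto simp: dist_norm)
  then show thesis
    using csubspace_diffD[OF assms(1) f, of 0 n] that by auto
qed

lemma rel_norm_scale_le:
  assumes S: "hermitian_subspace S" and x: "x \<in> Domain S"
  shows "rel_norm (rel_scale t S) x \<le> \<bar>t\<bar> * rel_norm S x"
proof (rule field_le_epsilon)
  fix e :: real assume "e > 0"
  have "e / (\<bar>t\<bar> + 1) > 0"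
    using \<open>e > 0\<close> by (simp add: add_nonneg_pos)
  then obtain g where g: "(x, g) \<in> S" "norm g < rel_norm S x + e / (\<bar>t\<bar> + 1)"
    by (rule rel_norm_approx[OF csubspace_if_hermitian[OF S] x])
  have "rel_norm (rel_scale t S) x \<le> \<bar>t\<bar> * norm g"
    using rel_norm_le[OF csubspace_if_hermitian[OF hermitian_rel_scale[OF S]] rel_scaleI[OF g(1), of t]]
    by simp
  also have "\<dots> \<le> \<bar>t\<bar> * (rel_norm S x + e / (\<bar>t\<bar> + 1))"
    using g(2) by (intro mult_left_mono) auto
  also have "\<dots> = \<bar>t\<bar> * rel_norm S x + e * (\<bar>t\<bar> / (\<bar>t\<bar> + 1))"
    by (simp add: algebra_simps)
  also have "\<dots> \<le> \<bar>t\<bar> * rel_norm S x + e"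
    using \<open>e > 0\<close> by (simp add: field_simps add_nonneg_pos)
  finally show "rel_norm (rel_scale t S) x \<le> \<bar>t\<bar> * rel_norm S x + e" .
qed

text \<open>
  The relative bound uses \<open>\<parallel>f\<parallel>\<close> for all \<open>f \<in> T(x)\<close> in place of \<open>\<parallel>T(x)\<parallel>\<close>. As \<open>\<parallel>T(x)\<parallel>\<close> is the
  infimum of these norms, the condition is the same, but quotients by \<open>T(0)\<close> no longer
  appear in it.
\<close>

definition bounded_with :: "real \<Rightarrow> real \<Rightarrow> ('a :: complex_inner \<times> 'a) set \<Rightarrow> ('a \<times> 'a) set \<Rightarrow> bool" where
  "bounded_with a b T S \<longleftrightarrow> a \<ge> 0 \<and> b \<ge> 0 \<and> Domain T \<subseteq> Domain S \<and>
    (\<forall>(x, f) \<in> T. rel_norm S x \<le> a * norm x + b * norm f)"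

lemma bounded_with_approx:
  assumes "bounded_with a b T S" "csubspace S" "(x, f) \<in> T" "e > 0"
  obtains g where "(x, g) \<in> S" "norm g < a * norm x + b * norm f + e"
proof -
  have x: "x \<in> Domain S" and le: "rel_norm S x \<le> a * norm x + b * norm f"
    using assms(1,3) by (auto simp: bounded_with_def)
  obtain g where "(x, g) \<in> S" "norm g < rel_norm S x + e"
    using assms(2) x assms(4) by (rule rel_norm_approx)
  with le show thesis
    by (intro that) auto
qed

lemma bounded_with_if_rel_bound_less:
  assumes T: "csubspace T" and bdd: "rel_bounded T S" and "rel_bound T S < q"
  obtains a b where "bounded_with a b T S" "b < q"
proof -
  let ?B = "{b. b \<ge> 0 \<and> (\<exists>a\<ge>0. \<forall>x\<in>Domain T. rel_norm S x \<le> a * norm x + b * rel_norm T x)}"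
  obtain c where "c \<ge> 0" "\<forall>x\<in>Domain T. rel_norm S x \<le> c * norm x + c * rel_norm T x"
    using bdd by (auto simp: rel_bounded_def algebra_simps)
  then have "?B \<noteq> {}" by blast
  then obtain b where "b \<in> ?B" "b < q"
    using cInf_lessD[of ?B q] assms(3) unfolding rel_bound_def by blast
  then obtain a where ab: "a \<ge> 0" "b \<ge> 0"
    "\<And>x. x \<in> Domain T \<Longrightarrow> rel_norm S x \<le> a * norm x + b * rel_norm T x"
    by blast
  have "rel_norm S x \<le> a * norm x + b * norm f" if "(x, f) \<in> T" for x f
  proof -
    have "b * rel_norm T x \<le> b * norm f"
      using rel_norm_le[OF T that] ab(2) by (rule mult_left_mono)
    then show ?thesis
      using ab(3)[OF DomainI[OF that]] by simp
  qed
  then have "bounded_with a b T S"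
    using ab bdd by (auto simp: bounded_with_def rel_bounded_def)
  with \<open>b < q\<close> show thesis using that by blast
qed

lemma bounded_with_scale:
  assumes "bounded_with a b T S" "hermitian_subspace S"
  shows "bounded_with (\<bar>t\<bar> * a) (\<bar>t\<bar> * b) T (rel_scale t S)"
proof -
  have "rel_norm (rel_scale t S) x \<le> \<bar>t\<bar> * a * norm x + \<bar>t\<bar> * b * norm f" if "(x, f) \<in> T" for x f
  proof -
    have "rel_norm (rel_scale t S) x \<le> \<bar>t\<bar> * rel_norm S x"
      using assms that by (intro rel_norm_scale_le) (auto simp: bounded_with_def)
    also have "\<dots> \<le> \<bar>t\<bar> * (a * norm x + b * norm f)"
      using assms(1) that by (intro mult_left_mono) (auto simp: bounded_with_def)
    finally show ?thesis by (simp add: algebra_simps)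
  qed
  then show ?thesis
    using assms(1) by (auto simp: bounded_with_def)
qed

text \<open>
  For \<open>0 \<le> t \<le> 1\<close> this is the chain
  \<open>\<parallel>S x\<parallel> \<le> a \<parallel>x\<parallel> + b \<parallel>T x\<parallel> \<le> a \<parallel>x\<parallel> + b \<parallel>(T + t S) x\<parallel> + b \<parallel>S x\<parallel>\<close>, solved for \<open>\<parallel>S x\<parallel>\<close>.
\<close>

lemma bounded_with_rel_plus_scale:
  assumes bd: "bounded_with a b T S" and "b < 1" and t: "0 \<le> t" "t \<le> 1"
    and T: "csubspace T" and S: "csubspace S" and S0: "S `` {0} \<subseteq> T `` {0}"
  shows "bounded_with (a / (1 - b)) (b / (1 - b)) (T +\<^sub>r rel_scale t S) S"
proof -
  have ab: "a \<ge> 0" "b \<ge> 0" "Domain T \<subseteq> Domain S"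
    using bd by (auto simp: bounded_with_def)
  have "rel_norm S x \<le> a / (1 - b) * norm x + b / (1 - b) * norm h"
    if xh: "(x, h) \<in> T +\<^sub>r rel_scale t S" for x h
  proof -
    obtain f g where fg: "(x, f) \<in> T" "(x, g) \<in> S" "h = f + t *\<^sub>R g"
      using xh by (auto elim!: rel_plusE rel_scaleE)
    have "rel_norm S x \<le> a * norm x + b * norm h + b * rel_norm S x"
    proof (rule field_le_epsilon)
      fix e :: real assume "e > 0"
      then obtain g' where g': "(x, g') \<in> S" "norm g' < rel_norm S x + e"
        using rel_norm_approx[OF S DomainI[OF fg(2)] \<open>e > 0\<close>] by blast
      \<comment> \<open>Replace the given \<open>g\<close> by the almost minimal \<open>g'\<close>, at the expense of changing \<open>f\<close> within \<open>T(x)\<close>.\<close>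
      have "t *\<^sub>R (g - g') \<in> T `` {0}"
        using csubspace_diff_mem_0[OF S fg(2) g'(1)] S0
        by (intro subspace_scale[OF csubspace_imp_subspace[OF csubspace_Image_0[OF T]]]) blast
      then have "(x, f + t *\<^sub>R (g - g')) \<in> T"
        using csubspace_addD[OF T fg(1), of 0 "t *\<^sub>R (g - g')"] by simp
      then have "(x, h - t *\<^sub>R g') \<in> T"
        by (simp add: fg(3) algebra_simps)
      then have "rel_norm S x \<le> a * norm x + b * norm (h - t *\<^sub>R g')"
        using bd by (auto simp: bounded_with_def)
      also have "norm (h - t *\<^sub>R g') \<le> norm h + norm g'"
        using norm_triangle_ineq4[of h "t *\<^sub>R g'"] mult_right_mono[OF t(2), of "norm g'"] t(1) by simp
      also have "\<dots> \<le> norm h + (rel_norm S x + e)"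
        using g'(2) by simp
      also have "b * (norm h + (rel_norm S x + e)) \<le> b * norm h + b * rel_norm S x + e"
        using \<open>b < 1\<close> \<open>e > 0\<close> by (simp add: algebra_simps)
      finally show "rel_norm S x \<le> a * norm x + b * norm h + b * rel_norm S x + e"
        using ab(2) by (simp add: mult_left_mono)
    qed
    then have "(1 - b) * rel_norm S x \<le> a * norm x + b * norm h"
      by (simp add: algebra_simps)
    then have "rel_norm S x \<le> (a * norm x + b * norm h) / (1 - b)"
      using \<open>b < 1\<close> by (simp add: pos_le_divide_eq mult.commute)
    then show ?thesis
      by (simp add: add_divide_distrib)
  qed
  moreover have "Domain (T +\<^sub>r rel_scale t S) \<subseteq> Domain S"
    using ab(3) by (auto elim!: rel_plusE)
  ultimately show ?thesis
    using ab(1,2) \<open>b < 1\<close> unfolding bounded_with_def by auto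
qed


section \<open>Stability under small perturbations\<close>

lemma closed_Image_0:
  fixes T :: "('a :: real_normed_vector \<times> 'a) set"
  assumes "closed T"
  shows "closed (T `` {0})"
proof -
  have "T `` {0} = (\<lambda>f. (0, f)) -` T" by auto
  then show ?thesis
    using assms by (auto intro!: closed_vimage continuous_intros)
qed

text \<open>
  Let \<open>(x\<^sub>n, h\<^sub>n) \<in> T + S\<close> converge. For \<open>(x\<^sub>n, f\<^sub>n) \<in> T\<close> with \<open>f\<^sub>n\<close> orthogonal to \<open>T(0)\<close>, the
  difference \<open>f\<^sub>m - f\<^sub>n\<close> is the shortest element of \<open>T(x\<^sub>m - x\<^sub>n)\<close>. Another element of this class is
  \<open>h\<^sub>m - h\<^sub>n - s\<close> with \<open>s \<in> S(x\<^sub>m - x\<^sub>n)\<close>, and comparing the two bounds \<open>(1 - b) \<parallel>f\<^sub>m - f\<^sub>n\<parallel>\<close> by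
  the distances of the given pairs. So \<open>f\<^sub>n\<close> converges and \<open>T\<close> contains the limit pair. The
  remainders \<open>h\<^sub>n - f\<^sub>n\<close> agree modulo \<open>T(0)\<close> with \<open>S(x\<^sub>n)\<close>, which tends to \<open>S(lim x\<^sub>n)\<close> by relative
  boundedness.
\<close>

lemma closed_rel_plus:
  fixes T S :: "('a :: chilbert_space \<times> 'a) set"
  assumes T: "csubspace T" "closed T" and S: "csubspace S" and S0: "S `` {0} \<subseteq> T `` {0}"
    and bd: "bounded_with a b T S" and "b < 1"
  shows "closed (T +\<^sub>r S)"
  unfolding closed_sequential_limits
proof (intro allI impI, elim conjE)
  fix P p assume P: "\<forall>n. P n \<in> T +\<^sub>r S" "P \<longlonglongrightarrow> p"
  let ?N = "T `` {0}"
  note N = csubspace_Image_0[OF T(1)] closed_Image_0[OF T(2)]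
  have ab: "a \<ge> 0" "b \<ge> 0" "Domain T \<subseteq> Domain S"
    using bd by (auto simp: bounded_with_def)
  define x h where "x n = fst (P n)" and "h n = snd (P n)" for n
  have xh: "(x n, h n) \<in> T +\<^sub>r S" for n
    using P(1) by (simp add: x_def h_def)
  have lim: "x \<longlonglongrightarrow> fst p" "h \<longlonglongrightarrow> snd p"
    unfolding x_def h_def by (intro tendsto_intros P)+
  have "\<exists>f. (x n, f) \<in> T \<and> (\<exists>g. (x n, g) \<in> S \<and> h n - g - f \<in> ?N) \<and> (\<forall>w\<in>?N. cinner f w = 0)" for n
  proof -
    obtain f g where fg: "(x n, f) \<in> T" "(x n, g) \<in> S" "h n = f + g"
      using xh by (rule rel_plusE)
    obtain v where v: "v \<in> ?N" "\<And>w. w \<in> ?N \<Longrightarrow> cinner (f - v) w = 0"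
      using orthogonal_decomposition[OF N(2,1)] by blast
    have "(x n, f - v) \<in> T"
      using csubspace_diffD[OF T(1) fg(1), of 0 v] v(1) by simp
    moreover have "h n - g - (f - v) \<in> ?N"
      using v(1) fg(3) by simp
    ultimately show ?thesis
      using v(2) fg(2) by blast
  qed
  then obtain f g where f: "\<And>n. (x n, f n) \<in> T" and f_orth: "\<And>n w. w \<in> ?N \<Longrightarrow> cinner (f n) w = 0"
    and g: "\<And>n. (x n, g n) \<in> S" and hgf: "\<And>n. h n - g n - f n \<in> ?N"
    by metis
  have f_diff: "norm (f m - f n) \<le> (a + 1) / (1 - b) * (norm (P m - P n))" for m n
  proof -
    have xf: "(x m - x n, f m - f n) \<in> T"
      using f by (intro csubspace_diffD[OF T(1)])
    have "norm (f m - f n) \<le> norm (h m - h n) + a * norm (x m - x n) + b * norm (f m - f n)"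
    proof (rule field_le_epsilon)
      fix e :: real assume "e > 0"
      then obtain s where s: "(x m - x n, s) \<in> S"
        "norm s < a * norm (x m - x n) + b * norm (f m - f n) + e"
        using bounded_with_approx[OF bd S xf] by blast
      \<comment> \<open>The error of \<open>f m - f n\<close> as a substitute for \<open>h m - h n - s\<close>; it lies in \<open>T(0)\<close>.\<close>
      define w where "w = h m - h n - s - (f m - f n)"
      have "g m - g n - s \<in> ?N"
        using csubspace_diff_mem_0[OF S csubspace_diffD[OF S g[of m] g[of n]] s(1)] S0 by blast
      moreover have "(h m - g m - f m) - (h n - g n - f n) \<in> ?N"
        by (intro complex_vector.subspace_diff[OF N(1)] hgf)
      ultimately have "((h m - g m - f m) - (h n - g n - f n)) + (g m - g n - s) \<in> ?N"
        by (intro complex_vector.subspace_add[OF N(1)])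
      then have "w \<in> ?N"
        unfolding w_def by (simp add: algebra_simps)
      then have "cinner (f m - f n) w = 0"
        using f_orth by (simp add: cinner_diff_left)
      then have "(norm (f m - f n))\<^sup>2 \<le> (norm (f m - f n + w))\<^sup>2"
        by (simp add: pythagoras)
      then have "norm (f m - f n) \<le> norm (f m - f n + w)"
        by (rule power2_le_imp_le) simp
      also have "\<dots> = norm (h m - h n - s)"
        by (simp add: w_def)
      also have "\<dots> \<le> norm (h m - h n) + norm s"
        by (rule norm_triangle_ineq4)
      finally show "norm (f m - f n)
          \<le> norm (h m - h n) + a * norm (x m - x n) + b * norm (f m - f n) + e"
        using s(2) by simp
    qed
    moreover have "norm (h m - h n) \<le> norm (P m - P n)"
      using dist_snd_le[of "P m" "P n"] by (simp add: h_def dist_norm)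
    moreover have "a * norm (x m - x n) \<le> a * norm (P m - P n)"
      using dist_fst_le[of "P m" "P n"] ab(1) by (intro mult_left_mono) (simp_all add: x_def dist_norm)
    ultimately have "(1 - b) * norm (f m - f n) \<le> (a + 1) * norm (P m - P n)"
      by (simp add: algebra_simps)
    then show ?thesis
      using \<open>b < 1\<close> by (simp add: field_simps)
  qed
  have "Cauchy f"
    by (rule Cauchy_if_norm_le[OF LIMSEQ_imp_Cauchy[OF P(2)] f_diff])
  then obtain f' where f': "f \<longlonglongrightarrow> f'"
    using Cauchy_convergent convergent_def by blast
  have xf': "(fst p, f') \<in> T"
    by (rule closed_sequentially[OF T(2) f tendsto_Pair[OF lim(1) f']])
  then obtain s where s: "(fst p, s) \<in> S"
    using ab(3) by blast
  have "\<exists>k. (x n - fst p, k) \<in> S \<and> norm k < a * norm (x n - fst p) + b * norm (f n - f') + 1 / Suc n" for n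
    using bounded_with_approx[OF bd S csubspace_diffD[OF T(1) f[of n] xf'], of "1 / Suc n"] by auto
  then obtain k where k: "\<And>n. (x n - fst p, k n) \<in> S"
    "\<And>n. norm (k n) < a * norm (x n - fst p) + b * norm (f n - f') + 1 / Suc n"
    by metis
  have "(\<lambda>n. a * norm (x n - fst p) + b * norm (f n - f') + 1 / Suc n)
      \<longlonglongrightarrow> a * norm (fst p - fst p) + b * norm (f' - f') + 0"
    by (intro tendsto_intros lim f' LIMSEQ_Suc[OF lim_1_over_n])
  then have "k \<longlonglongrightarrow> 0"
    using k(2) by (intro Lim_null_comparison[of k]) (auto intro!: always_eventually less_imp_le)
  have "h n - f n - s - k n \<in> ?N" for n
  proof -
    have "g n - s - k n \<in> ?N"
      using csubspace_diff_mem_0[OF S csubspace_diffD[OF S g[of n] s] k(1)] S0 by blast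
    then have "(h n - g n - f n) + (g n - s - k n) \<in> ?N"
      by (intro complex_vector.subspace_add[OF N(1)] hgf)
    then show ?thesis by (simp add: algebra_simps)
  qed
  moreover have "(\<lambda>n. h n - f n - s - k n) \<longlonglongrightarrow> snd p - f' - s - 0"
    by (intro tendsto_intros lim f' \<open>k \<longlonglongrightarrow> 0\<close>)
  ultimately have "snd p - f' - s - 0 \<in> ?N"
    by (rule closed_sequentially[OF N(2)])
  then have "(fst p, f' + (snd p - f' - s)) \<in> T"
    using csubspace_addD[OF T(1) xf', of 0 "snd p - f' - s"] by simp
  from rel_plusI[OF this s] show "p \<in> T +\<^sub>r S"
    by simp
qed

text \<open>
  Translating by elements of \<open>V\<close> upgrades the hypothesis to \<open>dist(u, V) \<le> q dist(u, v)\<close> for all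
  \<open>v \<in> V\<close>. Taking the infimum over \<open>v\<close> gives \<open>dist(u, V) \<le> q dist(u, V)\<close>, so the distance is \<open>0\<close>.
  This replaces the summation of a Neumann series.
\<close>

lemma dense_if_uniformly_close:
  fixes V :: "'a :: real_normed_vector set"
  assumes V: "subspace V" and "q < 1" and close: "\<And>u. infdist u V \<le> q * norm u"
  shows "closure V = UNIV"
proof -
  have ne: "V \<noteq> {}"
    using subspace_0[OF V] by blast
  have "infdist u V = 0" for u
  proof (rule ccontr)
    assume "infdist u V \<noteq> 0"
    then have pos: "infdist u V > 0"
      using infdist_nonneg[of u V] by linarith
    have shift: "infdist u V \<le> q * dist u v" if "v \<in> V" for v
    proof -
      have "infdist u V \<le> dist (u - v) w" if "w \<in> V" for w
        using infdist_le[OF subspace_add[OF V \<open>v \<in> V\<close> that], of u] by (simp add: dist_norm diff_diff_eq)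
      then have "infdist u V \<le> infdist (u - v) V"
        using ne by (subst (2) infdist_def) (auto intro!: cINF_greatest)
      also have "\<dots> \<le> q * dist u v"
        using close[of "u - v"] by (simp add: dist_norm)
      finally show ?thesis .
    qed
    \<comment> \<open>The sign of \<open>q\<close> matters for dividing by it; \<open>q \<le> 0\<close> would force all distances to vanish.\<close>
    have "q > 0"
    proof (rule ccontr)
      assume "\<not> q > 0"
      then have "q * dist u 0 \<le> 0" by (simp add: mult_nonpos_nonneg)
      then show False using shift[OF subspace_0[OF V]] pos by linarith
    qed
    have "infdist u V / q \<le> dist u v" if "v \<in> V" for v
      using shift[OF that] \<open>q > 0\<close> by (simp add: field_simps)
    then have "infdist u V / q \<le> infdist u V"
      using ne by (subst (2) infdist_def) (auto intro!: cINF_greatest)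
    then have "infdist u V \<le> q * infdist u V"
      using \<open>q > 0\<close> by (simp add: field_simps)
    then show False
      using mult_strict_right_mono[OF \<open>q < 1\<close> pos] by simp
  qed
  then show ?thesis
    using in_closure_iff_infdist_zero[OF ne] by blast
qed

lemma rel_shift_range_rel_plus_eq_UNIV:
  fixes T S :: "('a :: chilbert_space \<times> 'a) set"
  assumes sa: "self_adjoint T" and S: "hermitian_subspace S" and S0: "S `` {0} \<subseteq> T `` {0}"
    and bd: "bounded_with a b T S" and r: "r \<noteq> 0" "a / \<bar>r\<bar> + b < 1"
  shows "rel_shift_range (\<i> * of_real r) (T +\<^sub>r S) = UNIV"
proof -
  let ?c = "\<i> * complex_of_real r" and ?R = "rel_shift_range (\<i> * complex_of_real r) (T +\<^sub>r S)"
  note T = hermitian_if_self_adjoint[OF sa] csubspace_if_hermitian[OF hermitian_if_self_adjoint[OF sa]]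
    closed_if_self_adjoint[OF sa]
  note cS = csubspace_if_hermitian[OF S]
  have ab: "a \<ge> 0" "b \<ge> 0"
    using bd by (auto simp: bounded_with_def)
  then have "b < 1"
    using r by (smt (verit) divide_nonneg_nonneg abs_ge_zero)
  have "infdist u ?R \<le> (a / \<bar>r\<bar> + b) * norm u" for u
  proof (rule field_le_epsilon)
    fix e :: real assume "e > 0"
    have "u \<in> rel_shift_range ?c T"
      using rel_shift_range_eq_UNIV[OF sa r(1)] by simp
    then obtain x f where xf: "(x, f) \<in> T" "u = f - ?c *\<^sub>C x"
      by (rule rel_shift_rangeE)
    obtain g where g: "(x, g) \<in> S" "norm g < a * norm x + b * norm f + e"
      using bounded_with_approx[OF bd cS xf(1) \<open>e > 0\<close>] by blast
    have "f + g - ?c *\<^sub>C x \<in> ?R"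
      by (intro rel_shift_rangeI rel_plusI xf(1) g(1))
    then have "infdist u ?R \<le> dist u (f + g - ?c *\<^sub>C x)"
      by (rule infdist_le)
    also have "\<dots> = norm g"
      by (simp add: xf(2) dist_norm)
    also have "\<dots> \<le> a * norm x + b * norm f + e"
      using g(2) by simp
    also have "a * norm x \<le> a / \<bar>r\<bar> * norm u"
      using mult_left_mono[OF hermitian_norm_le(2)[OF T(1) xf(1), of r] ab(1)] r(1)
      by (simp add: xf(2) field_simps)
    also have "b * norm f \<le> b * norm u"
      using mult_left_mono[OF hermitian_norm_le(1)[OF T(1) xf(1), of r] ab(2)] by (simp add: xf(2))
    finally show "infdist u ?R \<le> (a / \<bar>r\<bar> + b) * norm u + e"
      by (simp add: algebra_simps)
  qed
  then have "closure ?R = UNIV"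
    using T(2) cS r(2)
    by (intro dense_if_uniformly_close csubspace_imp_subspace csubspace_rel_shift_range csubspace_rel_plus)
  moreover have "closed ?R"
    using closed_rel_plus[OF T(2,3) cS S0 bd \<open>b < 1\<close>] hermitian_rel_plus[OF T(1) S] r(1)
    by (intro closed_rel_shift_range)
  ultimately show ?thesis
    by simp
qed

text \<open>
  The Kato--Rellich theorem for linear relations: as \<open>b < 1\<close>, a large \<open>r\<close> brings \<open>a / r + b\<close>
  below \<open>1\<close>, and the range criterion applies with \<open>c = i r\<close>.
\<close>

lemma self_adjoint_rel_plus:
  fixes T S :: "('a :: chilbert_space \<times> 'a) set"
  assumes sa: "self_adjoint T" and S: "hermitian_subspace S" and S0: "S `` {0} \<subseteq> T `` {0}"
    and bd: "bounded_with a b T S" and "b < 1"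
  shows "self_adjoint (T +\<^sub>r S)"
proof -
  have "a \<ge> 0"
    using bd by (auto simp: bounded_with_def)
  \<comment> \<open>Any \<open>r > a / (1 - b)\<close> would do; the summand \<open>1\<close> makes \<open>r\<close> positive and the inequality strict.\<close>
  define r where "r = (a + 1) / (1 - b)"
  have "r > 0" "a / r < 1 - b"
    using \<open>a \<ge> 0\<close> \<open>b < 1\<close> by (auto simp: r_def field_simps)
  then have "rel_shift_range (\<i> * of_real r) (T +\<^sub>r S) = UNIV"
    "rel_shift_range (\<i> * of_real (- r)) (T +\<^sub>r S) = UNIV"
    by (intro rel_shift_range_rel_plus_eq_UNIV[OF sa S S0 bd]; simp)+
  then show ?thesis
    using hermitian_rel_plus[OF hermitian_if_self_adjoint[OF sa] S]
    by (intro self_adjoint_if_rel_shift_range_eq_UNIV[of _ "\<i> * of_real r"]) simp_all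
qed

text \<open>
  Induction along the relations \<open>T + (1 - k / n) S\<close>, from \<open>T + S\<close> at \<open>k = 0\<close> to \<open>T\<close> at \<open>k = n\<close>,
  each step being the perturbation by \<open>- S / n\<close>.
\<close>

lemma self_adjoint_if_rel_plus:
  fixes T S :: "('a :: chilbert_space \<times> 'a) set"
  assumes T: "csubspace T" and S: "hermitian_subspace S" and S0: "S `` {0} \<subseteq> T `` {0}"
    and bd: "bounded_with a b T S" and "b < 1" and sa: "self_adjoint (T +\<^sub>r S)"
  shows "self_adjoint T"
proof -
  note cS = csubspace_if_hermitian[OF S]
  define b' where "b' = b / (1 - b)"
  obtain n :: nat where n: "b' < n" "n > 0"
    using reals_Archimedean2[of "max b' 0"] by (auto intro: that)
  have "self_adjoint (T +\<^sub>r rel_scale (1 - k / n) S)" if "k \<le> n" for k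
    using that
  proof (induction k)
    case 0
    then show ?case using sa by simp
  next
    case (Suc k)
    let ?A = "T +\<^sub>r rel_scale (1 - k / n) S"
    have "real k / n \<le> 1"
      using Suc.prems by simp
    then have "bounded_with (a / (1 - b)) b' ?A S"
      unfolding b'_def using bd \<open>b < 1\<close> T cS S0 by (intro bounded_with_rel_plus_scale) auto
    then have bd': "bounded_with (\<bar>- 1 / n\<bar> * (a / (1 - b))) (\<bar>- 1 / n\<bar> * b') ?A (rel_scale (- 1 / n) S)"
      using S by (rule bounded_with_scale)
    have less_1: "\<bar>- 1 / n\<bar> * b' < 1"
      using n by (simp add: field_simps)
    have "T `` {0} \<subseteq> ?A `` {0}"
    proof
      fix f assume "f \<in> T `` {0}"
      then have f: "(0, f) \<in> T"
        by simp
      have "(0, (1 - k / n) *\<^sub>R 0) \<in> rel_scale (1 - k / n) S"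
        using complex_vector.subspace_0[OF cS] by (intro rel_scaleI) (simp add: zero_prod_def)
      from rel_plusI[OF f this] show "f \<in> ?A `` {0}" by simp
    qed
    then have Image_0: "rel_scale (- 1 / n) S `` {0} \<subseteq> ?A `` {0}"
      using rel_scale_Image_0_subset[OF T S0] by blast
    have "self_adjoint ?A"
      using Suc by simp
    then have "self_adjoint (?A +\<^sub>r rel_scale (- 1 / n) S)"
      using hermitian_rel_scale[OF S] Image_0 bd' less_1 by (rule self_adjoint_rel_plus)
    then have "self_adjoint (T +\<^sub>r rel_scale (1 - k / n + - 1 / n) S)"
      by (simp only: rel_plus_scale_scale[OF T cS S0])
    also have "1 - k / n + - 1 / n = 1 - Suc k / n"
      by (simp add: add_divide_distrib)
    finally show ?case .
  qed
  from this[of n] show ?thesis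
    using n(2) bd rel_plus_scale_0[OF T, of S] by (simp add: bounded_with_def)
qed

theorem corollary3p2:
  fixes T S :: "('a :: chilbert_space \<times> 'a) set"
  assumes "hermitian_subspace T"
    and "hermitian_subspace S"
    and "Domain T \<subseteq> Domain S"
    and "S `` {0} \<subseteq> T `` {0}"
    and "rel_bounded T S"
    and "rel_bound T S < 1"
  shows "self_adjoint (T +\<^sub>r S) \<longleftrightarrow> self_adjoint T"
proof -
  note T = csubspace_if_hermitian[OF assms(1)]
  obtain a b where "bounded_with a b T S" "b < 1"
    using bounded_with_if_rel_bound_less[OF T assms(5,6)] by blast
  then show ?thesis
    using self_adjoint_rel_plus[OF _ assms(2,4)] self_adjoint_if_rel_plus[OF T assms(2,4)] by blast
qed

end
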